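(* Let $p$ be twice differentiable on $\mathbb{R}$ with $p''$ a function of bounded variation, $\mathbf{V}(p'')=V_2<\infty$. Suppose the kernel $K$ (a probability density) has null expectation, $\int xK(x)\,dx=0$, and let $h_n=h_0n^{-1/5}$ for some constant $h_0>0$. Then the kernel estimator $p_n=p_{n,h_n}$ satisfies $$\mathrm{MISE}(p_n)\le\Bigl\{\frac{3\mu_2^2(K)V_2^{5/3}}{10\pi}h_0^4+\frac{R(K)}{h_0}\Bigr\}n^{-4/5}.$$
   Context: Let $X_1,\dots,X_n$ be i.i.d. real random variables with probability density $p$. The kernel $K$ is a square integrable probability density on $\mathbb{R}$. For a bandwidth $h>0$ set $K_h(x)=h^{-1}K(h^{-1}x)$ and $p_{n,h}(x)=\frac1n\sum_{j=1}^nK_h(x-X_j)$. Define $\mathrm{MISE}(p_{n,h})=\mathrm{E}\int\{p_{n,h}(x)-p(x)\}^2\,dx$. Notation: $\mu_k(K)=\int|x|^kK(x)\,dx$ and $R(K)=\int K^2(x)\,dx$ (assumed finite where they appear), $\mu_2^2(K)=(\mu_2(K))^2$; $\mathbf{V}(g)$ is the total variation of $g$ over the whole real line. *)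

theory Defs
  imports "HOL-Probability.Probability"
begin

definition prob_density :: "(real \<Rightarrow> real) \<Rightarrow> bool" where
  "prob_density f \<longleftrightarrow>
     f \<in> borel_measurable borel \<and> (\<forall>x. 0 \<le> f x) \<and> (\<integral>\<^sup>+x. ennreal (f x) \<partial>lborel) = 1"

(* The supremum ranges over all finite increasing sequences t 0 \<le> \<dots> \<le> t m; only the first
   m + 1 values of t enter the sum. *)
definition total_variation :: "(real \<Rightarrow> real) \<Rightarrow> ennreal" where
  "total_variation g =
     (SUP (m, t) \<in> {(m :: nat, t :: nat \<Rightarrow> real). mono t}. \<Sum>i<m. ennreal \<bar>g (t (Suc i)) - g (t i)\<bar>)"

definition abs_moment :: "nat \<Rightarrow> (real \<Rightarrow> real) \<Rightarrow> real" where
  "abs_moment k K = (LINT x|lborel. \<bar>x\<bar> ^ k * K x)"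

definition roughness :: "(real \<Rightarrow> real) \<Rightarrow> real" where
  "roughness K = (LINT x|lborel. (K x)\<^sup>2)"

definition scaled_kernel :: "(real \<Rightarrow> real) \<Rightarrow> real \<Rightarrow> real \<Rightarrow> real" where
  "scaled_kernel K h x = K (x / h) / h"

definition kernel_estimator ::
    "(real \<Rightarrow> real) \<Rightarrow> (nat \<Rightarrow> 'a \<Rightarrow> real) \<Rightarrow> nat \<Rightarrow> real \<Rightarrow> 'a \<Rightarrow> real \<Rightarrow> real" where
  "kernel_estimator K X n h \<omega> x = (\<Sum>j=1..n. scaled_kernel K h (x - X j \<omega>)) / real n"

(* Both integrals are taken in the extended nonnegative reals: the Bochner integral of a
   non-integrable squared error would be 0. *)
definition MISE :: "'a measure \<Rightarrow> ('a \<Rightarrow> real \<Rightarrow> real) \<Rightarrow> (real \<Rightarrow> real) \<Rightarrow> ennreal" where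
  "MISE M phat p = (\<integral>\<^sup>+\<omega>. (\<integral>\<^sup>+x. ennreal ((phat \<omega> x - p x)\<^sup>2) \<partial>lborel) \<partial>M)"

end

theory Submission
  imports Defs
begin

text \<open>The mean squared error at a point splits into variance and squared bias. The variance integrates
  to at most \<open>R(K) / (n h)\<close>. By Taylor's formula with integral remainder, the centering of \<open>K\<close> and the
  Cauchy-Schwarz inequality, the squared bias integrates to at most
  \<open>h\<^sup>4 \<mu>\<^sub>2\<^sup>2 / 4 \<integral> p''\<^sup>2\<close>. So everything rests on \<open>\<integral> p''\<^sup>2 \<le> 6 / (5 \<pi>) V\<^sup>5\<^sup>/\<^sup>3\<close>.

  The constant comes from a Fourier argument, but it is not optimal and an elementary one suffices.
  Integration by parts gives \<open>\<integral> p''\<^sup>2 = - \<integral> p' dp'' \<le> sup \<bar>p'\<bar> V\<close>. A large slope of \<open>p\<close> at a point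
  forces a lot of mass to its right, because \<open>p\<close> is nonnegative and the rate at which \<open>p'\<close> can grow
  and decay is limited by \<open>V\<close>; as the mass is 1, this yields \<open>20 \<bar>p'\<bar>\<^sup>3 \<le> V\<^sup>2\<close>, and
  \<open>20 \<ge> (5 \<pi> / 6)\<^sup>3\<close>.\<close>

section \<open>Densities whose second derivative has bounded variation\<close>

text \<open>By homogeneity take \<open>c = 1\<close>: after clearing denominators the difference is a cubic in \<open>b\<close> with
  minimum near \<open>b = 0.63\<close>, whence the square in the proof.\<close>

lemma cubic_bound:
  fixes a b c :: real
  assumes "0 < a" "0 < b" "a + b = c"
  shows "5 / c\<^sup>2 \<le> 1 / (a * b) + 2 / (3 * b\<^sup>2)"
proof -
  \<comment> \<open>The linear factor is chosen so that the coefficients of \<open>b ^ 3\<close> and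
    \<open>b\<^sup>2 * c\<close> become 15 and -15. The excess 0.0395 of the coefficient of
    \<open>b * c\<^sup>2\<close> over 1 is later absorbed by the slack at \<open>c ^ 3\<close>, as
    \<open>b\<close> is at most \<open>c\<close>.\<close>
  have "0 \<le> 3 * (b - 63/100 * c)\<^sup>2 * (5 * b + 13/10 * c)" using assms by auto
  also have "\<dots> = 15 * b ^ 3 - 15 * (b\<^sup>2 * c) + 10395/10000 * (b * c\<^sup>2) + 154791/100000 * c ^ 3"
    by (simp add: power2_eq_square power3_eq_cube field_simps)
  finally have "15 * (b\<^sup>2 * c) - 15 * b ^ 3 \<le> 10395/10000 * (b * c\<^sup>2) + 154791/100000 * c ^ 3"
    by linarith
  moreover have "b * c\<^sup>2 \<le> c ^ 3"
    using assms by (simp add: power3_eq_cube power2_eq_square mult_right_mono)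
  moreover have "0 \<le> c ^ 3" using assms by auto
  ultimately have "15 * (b\<^sup>2 * c) - 15 * b ^ 3 \<le> b * c\<^sup>2 + 2 * c ^ 3" by linarith
  then have "15 * b\<^sup>2 * (c - b) \<le> (3 * b + 2 * (c - b)) * c\<^sup>2"
    by (simp add: power2_eq_square power3_eq_cube algebra_simps)
  moreover have "c - b = a" using assms(3) by simp
  ultimately have "15 * b\<^sup>2 * a \<le> (3 * b + 2 * a) * c\<^sup>2" by simp
  then have "5 * (3 * a * b\<^sup>2) \<le> (3 * b + 2 * a) * c\<^sup>2" by (simp add: ac_simps)
  moreover have "0 < 3 * a * b\<^sup>2" using assms by simp
  ultimately have "5 \<le> (3 * b + 2 * a) * c\<^sup>2 / (3 * a * b\<^sup>2)" by (simp add: pos_le_divide_eq)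
  then have "5 / c\<^sup>2 \<le> (3 * b + 2 * a) / (3 * a * b\<^sup>2)"
    using assms by (intro mult_imp_div_pos_le) auto
  moreover have "(3 * b + 2 * a) / (3 * a * b\<^sup>2) = 1 / (a * b) + 2 / (3 * b\<^sup>2)"
    using assms by (simp add: add_divide_distrib power2_eq_square)
  ultimately show ?thesis by simp
qed

text \<open>The derivatives are parameters rather than \<open>deriv\<close> terms, so that the
  mirror image of a density is again an instance. With the variation bound stated for finite real
  sums, each use of it amounts to choosing points.\<close>

locale bv_density =
  fixes p F g :: "real \<Rightarrow> real" and V :: real
  assumes p_nonneg: "0 \<le> p x"
    and p_integral: "(\<integral>\<^sup>+x. ennreal (p x) \<partial>lborel) = 1"
    and p_deriv: "(p has_real_derivative F x) (at x)"
    and F_deriv: "(F has_real_derivative g x) (at x)"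
    and variation: "mono (t :: nat \<Rightarrow> real) \<Longrightarrow> (\<Sum>i<m. \<bar>g (t (Suc i)) - g (t i)\<bar>) \<le> V"
begin

section \<open>Regularity, Taylor expansion and use of the unit mass\<close>

lemma continuous_p: "continuous_on S p"
  using p_deriv by (meson DERIV_isCont continuous_at_imp_continuous_on)

lemma continuous_F: "continuous_on S F"
  using F_deriv by (meson DERIV_isCont continuous_at_imp_continuous_on)

lemma measurable_p [measurable]: "p \<in> borel_measurable borel"
  by (intro borel_measurable_continuous_onI continuous_p)

lemma measurable_F [measurable]: "F \<in> borel_measurable borel"
  by (intro borel_measurable_continuous_onI continuous_F)

text \<open>The Lagrange remainder uses \<open>g\<close> only as a pointwise derivative. The bounds
  on \<xi> are written with \<open>min\<close> and \<open>max\<close> so that the expansion serves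
  both to the left and to the right of \<open>x\<close>.\<close>

lemma taylor_two:
  obtains \<xi> where "min x y \<le> \<xi>" "\<xi> \<le> max x y" "p y = p x + F x * (y - x) + g \<xi> * (y - x)\<^sup>2 / 2"
proof (cases "x = y")
  case True
  then show ?thesis using that[of x] by simp
next
  case False
  define diff where "diff = (\<lambda>m::nat. if m = 0 then p else if m = 1 then F else g)"
  have "\<exists>t. (if y < x then y < t \<and> t < x else x < t \<and> t < y) \<and>
    p y = (\<Sum>m<2. (diff m x / fact m) * (y - x)^m) + (diff 2 t / fact 2) * (y - x)^2"
    by (rule Taylor[where a = "min x y" and b = "max x y"])
       (use False p_deriv F_deriv in \<open>auto simp: diff_def less_2_cases_iff\<close>)
  then obtain t where "(if y < x then y < t \<and> t < x else x < t \<and> t < y)"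
    "p y = (\<Sum>m<2. (diff m x / fact m) * (y - x)^m) + (diff 2 t / fact 2) * (y - x)^2" by blast
  then show ?thesis using that[of t]
    by (auto simp: diff_def numeral_2_eq_2 split: if_splits)
qed

text \<open>Turns a pointwise minorant of \<open>p\<close> on an interval into an inequality between
  numbers: the mass outside the interval is nonnegative and the total is 1.\<close>

lemma integral_le_1:
  assumes "(q has_integral I) {a..b}" "\<And>x. a \<le> x \<Longrightarrow> x \<le> b \<Longrightarrow> q x \<le> p x"
  shows "I \<le> 1"
proof -
  have int: "integrable lborel p"
    by (rule integrableI_nonneg) (use p_nonneg p_integral in auto)
  have one: "integral\<^sup>L lborel p = 1"
    using p_integral by (subst integral_eq_nn_integral) (auto simp: p_nonneg)
  have ab: "set_integrable lborel {a..b} p"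
    unfolding set_integrable_def using int by (intro integrable_mult_indicator) auto
  have "(p has_integral (LINT x:{a..b}|lborel. p x)) {a..b}"
    using set_borel_integral_eq_integral(1,2)[OF ab] 
    by (metis integrable_integral)
  then have "I \<le> (LINT x:{a..b}|lborel. p x)"
    by (rule has_integral_le[OF assms(1)]) (use assms(2) in auto)
  also have "\<dots> \<le> integral\<^sup>L lborel p"
    unfolding set_lebesgue_integral_def
    by (rule integral_mono) (use int ab p_nonneg in \<open>auto simp: set_integrable_def indicator_def\<close>)
  finally show ?thesis using one by simp
qed

section \<open>Behaviour of \<open>g\<close> at infinity\<close>

lemma no_escape_up:
  assumes "0 < \<epsilon>"
  shows "\<exists>t\<ge>N. g t < \<epsilon>"
proof (rule ccontr)
  assume "\<not> ?thesis"
  then have g: "\<epsilon> \<le> g t" if "N \<le> t" for t using that by force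
  \<comment> \<open>If \<open>g\<close> stayed above \<epsilon>, then \<open>p\<close> would grow
    quadratically and exceed the unit mass on an interval of length 1. From distance
    \<open>S\<close> on, the quadratic term beats the linear one by at least \<open>2 * s\<close>;
    the summand 1 ensures that this is at least 2.\<close>
  define S where "S = 2 * (\<bar>F N\<bar> + 2) / \<epsilon> + 1"
  have S1: "1 \<le> S" using assms by (simp add: S_def)
  have "2 \<le> p t" if t: "N + S \<le> t" for t
  proof -
    define s where "s = t - N"
    have s: "S \<le> s" using t by (simp add: s_def)
    obtain \<xi> where \<xi>: "min N t \<le> \<xi>" "p t = p N + F N * s + g \<xi> * s\<^sup>2 / 2"
      using taylor_two unfolding s_def by metis
    have "\<epsilon> \<le> g \<xi>" using \<xi> t S1 by (intro g) auto
    then have "\<epsilon> * s\<^sup>2 \<le> g \<xi> * s\<^sup>2" by (intro mult_right_mono) auto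
    then have "p N + F N * s + \<epsilon> * s * s / 2 \<le> p t" using \<xi>(2) by (simp add: power2_eq_square)
    moreover have "2 * (\<bar>F N\<bar> + 2) / \<epsilon> \<le> s" using s by (simp add: S_def)
    then have "2 * (\<bar>F N\<bar> + 2) \<le> \<epsilon> * s" using assms by (simp add: pos_divide_le_eq mult.commute)
    then have "2 * (\<bar>F N\<bar> + 2) * s \<le> \<epsilon> * s * s"
      using s S1 by (intro mult_right_mono) auto
    moreover have "- \<bar>F N\<bar> * s \<le> F N * s"
      using s S1 by (intro mult_right_mono) auto
    ultimately show ?thesis using p_nonneg[of N] s S1 by (simp add: algebra_simps)
  qed
  then have "2 \<le> (1::real)"
    using has_integral_const_real[of "2::real" "N + S" "N + S + 1"]
    by (intro integral_le_1[of "\<lambda>_. 2" 2 "N + S" "N + S + 1"]) auto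
  then show False by simp
qed

lemma no_escape_down:
  assumes "0 < \<epsilon>"
  shows "\<exists>t\<ge>N. - \<epsilon> < g t"
proof (rule ccontr)
  assume "\<not> ?thesis"
  then have g: "g t \<le> - \<epsilon>" if "N \<le> t" for t using that by force
  \<comment> \<open>Here the contradiction is with the sign of \<open>p\<close>: at distance
    \<open>S\<close> the quadratic term outweighs both the linear term and
    \<open>p N\<close>.\<close>
  define S where "S = 2 * (\<bar>F N\<bar> + p N + 1) / \<epsilon> + 1"
  have S1: "1 \<le> S" using assms p_nonneg[of N] by (simp add: S_def)
  define t where "t = N + S"
  obtain \<xi> where \<xi>: "min N t \<le> \<xi>" "p t = p N + F N * (t - N) + g \<xi> * (t - N)\<^sup>2 / 2"
    using taylor_two by metis
  have "g \<xi> \<le> - \<epsilon>" using \<xi> S1 by (intro g) (auto simp: t_def)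
  then have 1: "g \<xi> * S\<^sup>2 \<le> - \<epsilon> * S\<^sup>2" by (intro mult_right_mono) auto
  have "\<epsilon> * S \<ge> 2 * (\<bar>F N\<bar> + p N + 1)" using assms by (simp add: S_def field_simps)
  then have 2: "2 * (\<bar>F N\<bar> + p N + 1) * S \<le> \<epsilon> * S * S"
    using S1 by (intro mult_right_mono) auto
  have 3: "F N * S \<le> \<bar>F N\<bar> * S" using S1 by (intro mult_right_mono) auto
  have "(p N + 1) * 1 \<le> (p N + 1) * S" using S1 p_nonneg[of N] by (intro mult_left_mono) auto
  then have "p t < 0" using \<xi>(2) 1 2 3
    by (simp add: power2_eq_square algebra_simps t_def)
  then show False using p_nonneg[of t] by simp
qed

text \<open>Transfers every right-hand statement to the left. Under reflection the slope changes
  sign while the second derivative does not.\<close>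

lemma reflect: "bv_density (\<lambda>x. p (- x)) (\<lambda>x. - F (- x)) (\<lambda>x. g (- x)) V"
proof
  show "0 \<le> p (- x)" for x by (rule p_nonneg)
  show "(\<integral>\<^sup>+x. ennreal (p (- x)) \<partial>lborel) = 1"
    using nn_integral_real_affine[of "\<lambda>x. ennreal (p x)" "-1" 0] p_integral by simp
  show "((\<lambda>x. p (- x)) has_real_derivative - F (- x)) (at x)" for x
    using DERIV_chain2[OF p_deriv DERIV_minus[OF DERIV_ident], of x UNIV] by simp
  show "((\<lambda>x. - F (- x)) has_real_derivative g (- x)) (at x)" for x
    using DERIV_minus[OF DERIV_chain2[OF F_deriv DERIV_minus[OF DERIV_ident], of x UNIV]] by simp
  fix t :: "nat \<Rightarrow> real" and m assume t: "mono t"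
  \<comment> \<open>Reverses the first \<open>m + 1\<close> points. Beyond \<open>m\<close> the
    truncated subtraction makes \<open>t'\<close> constant, so it is monotone on all of the
    naturals.\<close>
  define t' where "t' = (\<lambda>i. - t (m - i))"
  have "mono t'" using t by (auto simp: mono_def t'_def)
  have "(\<Sum>i<m. \<bar>g (- t (Suc i)) - g (- t i)\<bar>) = (\<Sum>i<m. \<bar>g (- t (Suc (m - Suc i))) - g (- t (m - Suc i))\<bar>)"
    using sum.nat_diff_reindex[of "\<lambda>i. \<bar>g (- t (Suc i)) - g (- t i)\<bar>" m] by simp
  also have "\<dots> = (\<Sum>i<m. \<bar>g (t' (Suc i)) - g (t' i)\<bar>)"
    by (rule sum.cong) (auto simp: t'_def Suc_diff_Suc)
  also have "\<dots> \<le> V" by (rule variation[OF \<open>mono t'\<close>])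
  finally show "(\<Sum>i<m. \<bar>g (- t (Suc i)) - g (- t i)\<bar>) \<le> V" .
qed

text \<open>The variation of \<open>g\<close> to the right of \<open>b\<close> is nearly
  \<open>\<bar>g b\<bar>\<close> or more, because \<open>g\<close> must come close to 0 or cross
  it.\<close>

lemma tail_right:
  assumes "0 < \<epsilon>"
  shows "\<exists>c\<ge>b. \<bar>g b\<bar> \<le> \<bar>g b - g c\<bar> + \<epsilon>"
  using no_escape_up[OF assms, of b] no_escape_down[OF assms, of b]
  by (cases "0 \<le> g b") force+

lemma tail_left:
  assumes "0 < \<epsilon>"
  shows "\<exists>c\<le>b. \<bar>g b\<bar> \<le> \<bar>g b - g c\<bar> + \<epsilon>"
proof -
  interpret r: bv_density "\<lambda>x. p (- x)" "\<lambda>x. - F (- x)" "\<lambda>x. g (- x)" V by (rule reflect)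
  obtain c where "- b \<le> c" "\<bar>g b\<bar> \<le> \<bar>g b - g (- c)\<bar> + \<epsilon>"
    using r.tail_right[OF assms, of "- b"] by auto
  then show ?thesis by (intro exI[of _ "- c"]) auto
qed

text \<open>The factor 2 arises because a descent has to be paid for twice: \<open>g\<close> climbs
  from near or below 0 up to \<open>g x\<close>, falls to \<open>g y\<close>, and climbs back to
  near or above 0. The four points of \<open>t\<close> record these three moves.\<close>

lemma drop_le:
  assumes "x \<le> y"
  shows "2 * (g x - g y) \<le> V"
proof (rule field_le_epsilon)
  fix e :: real assume "0 < e"
  then have e: "0 < e / 2" by simp
  interpret r: bv_density "\<lambda>x. p (- x)" "\<lambda>x. - F (- x)" "\<lambda>x. g (- x)" V by (rule reflect)
  obtain c where c: "- x \<le> c" "g (- c) < e / 2" using r.no_escape_up[OF e] by blast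
  obtain d where d: "y \<le> d" "- (e / 2) < g d" using no_escape_down[OF e] by blast
  define t where "t = (\<lambda>i::nat. if i = 0 then - c else if i = 1 then x else if i = 2 then y else d)"
  have "mono t" using c d assms by (auto simp: mono_def t_def)
  from variation[OF this, of 3]
  have "\<bar>g x - g (- c)\<bar> + \<bar>g y - g x\<bar> + \<bar>g d - g y\<bar> \<le> V"
    by (simp add: t_def eval_nat_numeral)
  then show "2 * (g x - g y) \<le> V + e" using c d by argo
qed

section \<open>Bounds on \<open>g\<close> and on the slope by the variation\<close>

lemma V_nonneg: "0 \<le> V"
  using variation[of "\<lambda>_. 0" 0] by (simp add: mono_def)

lemma abs_g_le: "\<bar>g x\<bar> \<le> V"
proof (rule field_le_epsilon)
  fix e :: real assume "0 < e"
  then obtain c where c: "x \<le> c" "\<bar>g x\<bar> \<le> \<bar>g x - g c\<bar> + e" using tail_right by blast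
  define t where "t = (\<lambda>i::nat. if i = 0 then x else c)"
  have "mono t" using c by (auto simp: mono_def t_def)
  from variation[OF this, of 1] show "\<bar>g x\<bar> \<le> V + e" using c by (simp add: t_def)
qed

text \<open>Let \<open>a\<close> bound \<open>g\<close> to the left of \<open>z\<close> and \<open>-b\<close> bound it from below to the right. Nonnegativity of \<open>p\<close>
  on the left forces \<open>p z \<ge> (F z)\<^sup>2 / (2 a)\<close>; then \<open>p\<close> lies above a parabola on
  \<open>{z..z + 2 F z / b}\<close>, whose area is at most 1. Finally \<open>a + b = V / 2\<close> because \<open>g\<close> returns to 0
  at both ends.\<close>

lemma F_cubed_le: "20 * F z ^ 3 \<le> V\<^sup>2"
proof (cases "0 < F z")
  case False
  then have "F z ^ 3 \<le> 0" by (simp add: power_le_zero_eq)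
  then show ?thesis using zero_le_power2[of V] by linarith
next
  case True
  define A where "A = F z"
  have A: "0 < A" using True by (simp add: A_def)
  define a where "a = (SUP x\<in>{..z}. g x)"
  define b where "b = V / 2 - a"
  have bdd: "bdd_above (g ` {..z})"
    by (rule bdd_aboveI2[of _ _ V]) (use abs_g_le in \<open>simp add: abs_le_iff\<close>)
  have left: "g x \<le> a" if "x \<le> z" for x
    unfolding a_def using that by (intro cSUP_upper bdd) auto
  have right: "- b \<le> g y" if "z \<le> y" for y
  proof -
    have "a \<le> V / 2 + g y" unfolding a_def
    proof (rule cSUP_least)
      fix x assume "x \<in> {..z}"
      then show "g x \<le> V / 2 + g y" using drop_le[of x y] that by simp
    qed auto
    then show ?thesis by (simp add: b_def)
  qed
  have pl: "0 \<le> p z - A * s + a * s\<^sup>2 / 2" if s: "0 \<le> s" for s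
  proof -
    obtain \<xi> where \<xi>: "\<xi> \<le> max z (z - s)" "p (z - s) = p z + A * ((z - s) - z) + g \<xi> * ((z - s) - z)\<^sup>2 / 2"
      using taylor_two unfolding A_def by metis
    have "g \<xi> * s\<^sup>2 \<le> a * s\<^sup>2" using \<xi> s by (intro mult_right_mono left) auto
    then show ?thesis using \<xi>(2) p_nonneg[of "z - s"] by simp
  qed
  have pr: "p z + A * (x - z) - b * (x - z)\<^sup>2 / 2 \<le> p x" if x: "z \<le> x" for x
  proof -
    obtain \<xi> where \<xi>: "min z x \<le> \<xi>" "p x = p z + A * (x - z) + g \<xi> * (x - z)\<^sup>2 / 2"
      using taylor_two unfolding A_def by metis
    have "- b * (x - z)\<^sup>2 \<le> g \<xi> * (x - z)\<^sup>2" using \<xi> x by (intro mult_right_mono right) auto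
    then show ?thesis using \<xi>(2) by simp
  qed
  have a: "0 < a"
  proof (rule ccontr)
    assume "\<not> 0 < a"
    \<comment> \<open>With \<open>a\<close> nonpositive, \<open>p\<close> would lie below its
      tangent to the left of \<open>z\<close>, and the tangent reaches -1 at distance
      \<open>(p z + 1) / A\<close>.\<close>
    then have "a * ((p z + 1) / A)\<^sup>2 \<le> 0" by (intro mult_nonpos_nonneg) auto
    then show False using pl[of "(p z + 1) / A"] A p_nonneg[of z] by simp
  qed
  have b: "0 < b"
  proof (rule ccontr)
    assume nb: "\<not> 0 < b"
    \<comment> \<open>With \<open>b\<close> nonpositive, \<open>p\<close> lies above its tangent to
      the right of \<open>z\<close>, and the tangent has risen by 2 at distance
      \<open>2 / A\<close>.\<close>
    have "2 \<le> p x" if x: "z + 2 / A \<le> x" for x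
    proof -
      have "0 < 2 / A" using A by simp
      then have zx: "z \<le> x" using x by linarith
      have "b * (x - z)\<^sup>2 \<le> 0" using nb by (intro mult_nonpos_nonneg) auto
      moreover have "A * (2 / A) \<le> A * (x - z)" using x A by (intro mult_left_mono) auto
      ultimately show ?thesis using pr[OF zx] A p_nonneg[of z] by simp
    qed
    then have "2 \<le> (1::real)"
      using has_integral_const_real[of "2::real" "z + 2 / A" "z + 2 / A + 1"]
      by (intro integral_le_1[of "\<lambda>_. 2" 2 "z + 2 / A" "z + 2 / A + 1"]) auto
    then show False by simp
  qed
  \<comment> \<open>\<open>A / a\<close> minimizes the quadratic in \<open>pl\<close>, so this
    choice gives the strongest lower bound on \<open>p z\<close>.\<close>
  have pz: "A\<^sup>2 / (2 * a) \<le> p z"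
    using pl[of "A / a"] A a by (simp add: field_simps power2_eq_square)
  \<comment> \<open>\<open>z + L\<close> is the point where the minorizing parabola has come back
    down to the height \<open>p z\<close>.\<close>
  define L where "L = 2 * A / b"
  have L: "0 < L" using A b by (simp add: L_def)
  define P where "P = (\<lambda>x. p z * (x - z) + A * (x - z)\<^sup>2 / 2 - b * (x - z) ^ 3 / 6)"
  have "((\<lambda>x. p z + A * (x - z) - b * (x - z)\<^sup>2 / 2) has_integral P (z + L) - P z) {z..z + L}"
    unfolding P_def using L
    by (intro fundamental_theorem_of_calculus)
      (auto simp flip: has_real_derivative_iff_has_vector_derivative
        intro!: derivative_eq_intros simp: power2_eq_square field_simps)
  then have "P (z + L) - P z \<le> 1"
    by (rule integral_le_1) (use pr in auto)
  then have "p z * L + A * L\<^sup>2 / 2 - b * L ^ 3 / 6 \<le> 1" by (simp add: P_def)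
  also have "p z * L + A * L\<^sup>2 / 2 - b * L ^ 3 / 6 = p z * (2 * A / b) + 2 / 3 * (A ^ 3 / b\<^sup>2)"
    using b by (simp add: L_def power2_eq_square power3_eq_cube field_simps)
  finally have "p z * (2 * A / b) + 2 / 3 * (A ^ 3 / b\<^sup>2) \<le> 1" .
  moreover have "A\<^sup>2 / (2 * a) * (2 * A / b) \<le> p z * (2 * A / b)"
    using pz A b by (intro mult_right_mono) auto
  ultimately have "A ^ 3 * (1 / (a * b) + 2 / (3 * b\<^sup>2)) \<le> 1"
    by (simp add: power2_eq_square power3_eq_cube algebra_simps)
  \<comment> \<open>Here \<open>a + b\<close> is \<open>V / 2\<close>, so the constant 5 of
    \<open>cubic_bound\<close> becomes 20 over the square of \<open>V\<close>.\<close>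
  moreover have "A ^ 3 * (5 / (V / 2)\<^sup>2) \<le> A ^ 3 * (1 / (a * b) + 2 / (3 * b\<^sup>2))"
    using A a b by (intro mult_left_mono cubic_bound) (auto simp: b_def)
  ultimately have "A ^ 3 * (5 / (V / 2)\<^sup>2) \<le> 1" by linarith
  moreover have "0 < V" using a b by (simp add: b_def)
  ultimately show ?thesis by (simp add: A_def field_simps)
qed

lemma abs_F_cubed_le: "20 * \<bar>F z\<bar> ^ 3 \<le> V\<^sup>2"
proof -
  interpret r: bv_density "\<lambda>x. p (- x)" "\<lambda>x. - F (- x)" "\<lambda>x. g (- x)" V by (rule reflect)
  show ?thesis
    using F_cubed_le[of z] r.F_cubed_le[of "- z"] by (cases "0 \<le> F z") auto
qed

text \<open>Both \<open>var_upto\<close> and \<open>var_upto - g\<close> are monotone. This gives measurability of \<open>g\<close> and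
  bounds the Riemann sum errors below without the continuity of \<open>g\<close>.\<close>

definition var_upto :: "real \<Rightarrow> real" where
  "var_upto x = Sup {\<Sum>i<m. \<bar>g (t (Suc i)) - g (t i)\<bar> | m t. mono (t :: nat \<Rightarrow> real) \<and> t m \<le> x}"

lemma var_upto_upper:
  assumes "mono (t :: nat \<Rightarrow> real)" "t m \<le> x"
  shows "(\<Sum>i<m. \<bar>g (t (Suc i)) - g (t i)\<bar>) \<le> var_upto x"
  unfolding var_upto_def
proof (rule cSup_upper)
  show "bdd_above {\<Sum>i<m. \<bar>g (t (Suc i)) - g (t i)\<bar> | m t. mono (t :: nat \<Rightarrow> real) \<and> t m \<le> x}"
    using variation by (intro bdd_aboveI[of _ V]) auto
qed (use assms in blast)

lemma var_upto_least:
  assumes "\<And>m t. mono (t :: nat \<Rightarrow> real) \<Longrightarrow> t m \<le> x \<Longrightarrow> (\<Sum>i<m. \<bar>g (t (Suc i)) - g (t i)\<bar>) \<le> C"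
  shows "var_upto x \<le> C"
  unfolding var_upto_def
proof (rule cSup_least)
  have "mono (\<lambda>_::nat. x)" by (simp add: mono_def)
  then show "{\<Sum>i<m. \<bar>g (t (Suc i)) - g (t i)\<bar> | m t. mono (t :: nat \<Rightarrow> real) \<and> t m \<le> x} \<noteq> {}"
    by blast
qed (use assms in blast)

lemma var_upto_nonneg: "0 \<le> var_upto x"
  using var_upto_upper[of "\<lambda>_. x" 0 x] by (simp add: mono_def)

lemma var_upto_le: "var_upto x \<le> V"
  by (rule var_upto_least) (rule variation)

lemma abs_diff_le_var_upto:
  assumes "x \<le> y"
  shows "\<bar>g y - g x\<bar> \<le> var_upto y - var_upto x"
proof -
  have "var_upto x \<le> var_upto y - \<bar>g y - g x\<bar>"
  proof (rule var_upto_least)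
    fix m and t :: "nat \<Rightarrow> real" assume t: "mono t" "t m \<le> x"
    \<comment> \<open>Any partition that ends at or before \<open>x\<close> is extended by
      \<open>x\<close> and \<open>y\<close>, which adds at least
      \<open>\<bar>g y - g x\<bar>\<close> to its sum. The sequence then stays at \<open>y\<close>,
      which keeps it monotone.\<close>
    define t' where "t' = (\<lambda>i. if i \<le> m then t i else if i = Suc m then x else y)"
    have "t i \<le> x" if "i \<le> m" for i using t that by (meson monoD order_trans)
    then have "mono t'" using t(1) assms by (fastforce simp: mono_def t'_def)
    from var_upto_upper[OF this, of "Suc (Suc m)" y]
    have "(\<Sum>i<m. \<bar>g (t' (Suc i)) - g (t' i)\<bar>) + \<bar>g x - g (t m)\<bar> + \<bar>g y - g x\<bar> \<le> var_upto y"
      by (simp add: t'_def)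
    moreover have "(\<Sum>i<m. \<bar>g (t' (Suc i)) - g (t' i)\<bar>) = (\<Sum>i<m. \<bar>g (t (Suc i)) - g (t i)\<bar>)"
      by (rule sum.cong) (auto simp: t'_def)
    ultimately show "(\<Sum>i<m. \<bar>g (t (Suc i)) - g (t i)\<bar>) \<le> var_upto y - \<bar>g y - g x\<bar>" by linarith
  qed
  then show ?thesis by simp
qed

lemma measurable_g [measurable]: "g \<in> borel_measurable borel"
proof -
  have "mono var_upto" using abs_diff_le_var_upto by (fastforce simp: mono_def)
  moreover have "mono (\<lambda>x. var_upto x - g x)"
    using abs_diff_le_var_upto by (fastforce simp: mono_def abs_le_iff)
  ultimately have "(\<lambda>x. var_upto x - (var_upto x - g x)) \<in> borel_measurable borel"
    by (intro borel_measurable_diff borel_measurable_mono)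
  then show ?thesis by simp
qed

lemma g_sq_set_integrable: "set_integrable lborel {a..b} (\<lambda>x. (g x)\<^sup>2)"
proof (rule set_integrable_bound[of lborel _ "\<lambda>_. V\<^sup>2"])
  show "AE x in lborel. x \<in> {a..b} \<longrightarrow> norm ((g x)\<^sup>2) \<le> norm (V\<^sup>2)"
    using abs_g_le V_nonneg by (auto intro!: power2_le_iff_abs_le[THEN iffD2])
qed (auto simp: set_borel_measurable_def intro: borel_integrable_atLeastAtMost')

lemma g_sq_integrable_on: "(\<lambda>x. (g x)\<^sup>2) integrable_on {a..b}"
  using set_borel_integral_eq_integral(1)[OF g_sq_set_integrable] .

text \<open>One step of the summation by parts of \<open>\<integral> g dF\<close>; the last term is the discretization error.\<close>

lemma integral_g_sq_step:
  assumes "x \<le> y" "\<And>x. \<bar>F x\<bar> \<le> S"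
  shows "integral {x..y} (\<lambda>u. (g u)\<^sup>2) \<le>
    g y * F y - g x * F x + S * \<bar>g y - g x\<bar> + V * (y - x) * (var_upto y - var_upto x)"
proof -
  have "(g has_integral F y - F x) {x..y}"
    using assms(1) F_deriv
    by (intro fundamental_theorem_of_calculus)
      (auto simp flip: has_real_derivative_iff_has_vector_derivative intro: has_field_derivative_at_within)
  \<comment> \<open>One factor of \<open>g u\<close> squared is frozen at the left endpoint, which
    leaves an integral known exactly from \<open>F\<close>. Freezing costs at most the bound
    \<open>V\<close> on the other factor times the variation over the cell.\<close>
  then have "((\<lambda>u. g x * g u + V * (var_upto y - var_upto x)) has_integral
      (g x * (F y - F x) + V * (var_upto y - var_upto x) * (y - x))) {x..y}"
    using has_integral_const_real[of "V * (var_upto y - var_upto x)" x y] assms(1)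
    by (intro has_integral_add has_integral_mult_right) (auto simp: mult.commute)
  moreover have "(g u)\<^sup>2 \<le> g x * g u + V * (var_upto y - var_upto x)" if "x \<le> u" "u \<le> y" for u
  proof -
    have "\<bar>g u - g x\<bar> \<le> var_upto y - var_upto x"
      using abs_diff_le_var_upto[of x u] abs_diff_le_var_upto[of u y] that by linarith
    then have "\<bar>g u\<bar> * \<bar>g u - g x\<bar> \<le> V * (var_upto y - var_upto x)"
      by (intro mult_mono abs_g_le) (auto simp: V_nonneg)
    moreover have "g u * (g u - g x) \<le> \<bar>g u\<bar> * \<bar>g u - g x\<bar>"
      by (metis abs_ge_self abs_mult)
    ultimately show ?thesis by (simp add: power2_eq_square algebra_simps)
  qed
  ultimately have "integral {x..y} (\<lambda>u. (g u)\<^sup>2) \<le> g x * (F y - F x) + V * (var_upto y - var_upto x) * (y - x)"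
    by (intro has_integral_le[OF integrable_integral[OF g_sq_integrable_on]]) auto
  \<comment> \<open>By Abel's rearrangement, \<open>g x * (F y - F x)\<close> equals
    \<open>g y * F y - g x * F x - F y * (g y - g x)\<close>; the first two terms telescope over
    consecutive cells.\<close>
  moreover have "- F y * (g y - g x) \<le> S * \<bar>g y - g x\<bar>"
    using mult_right_mono[OF assms(2)[of y], of "\<bar>g y - g x\<bar>"]
      abs_ge_minus_self[of "F y * (g y - g x)"] by (simp add: abs_mult)
  ultimately show ?thesis by (simp add: algebra_simps)
qed

text \<open>The steps are summed over a uniform partition. The boundary terms at \<open>a\<close>
  and \<open>b\<close> cost nothing extra, since \<open>\<bar>g a\<bar>\<close> and
  \<open>\<bar>g b\<bar>\<close> are paid for by variation outside the interval, up to \<epsilon>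
  each.\<close>

lemma integral_g_sq_le:
  assumes "a < b" and S: "\<And>x. \<bar>F x\<bar> \<le> S"
  shows "integral {a..b} (\<lambda>u. (g u)\<^sup>2) \<le> S * V"
proof -
  have S0: "0 \<le> S" using S[of 0] by linarith
  have bound: "integral {a..b} (\<lambda>u. (g u)\<^sup>2) \<le> S * (V + 2 * \<epsilon>) + V * V * ((b - a) / real N)"
    if "0 < \<epsilon>" "0 < N" for \<epsilon> N
  proof -
    define \<delta> where "\<delta> = (b - a) / real N"
    have \<delta>: "0 < \<delta>" using assms(1) that by (simp add: \<delta>_def)
    define t where "t = (\<lambda>i::nat. a + real i * \<delta>)"
    have "integral {a..t k} (\<lambda>u. (g u)\<^sup>2) \<le> g (t k) * F (t k) - g a * F a
       + S * (\<Sum>i<k. \<bar>g (t (Suc i)) - g (t i)\<bar>) + V * \<delta> * (var_upto (t k) - var_upto a)" for k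
    proof (induction k)
      case 0
      then show ?case by (simp add: t_def)
    next
      case (Suc k)
      have le: "a \<le> t k" "t k \<le> t (Suc k)" using \<delta> by (auto simp: t_def algebra_simps)
      have "t (Suc k) - t k = \<delta>" by (simp add: t_def algebra_simps)
      with integral_g_sq_step[OF le(2) S] Suc
        Henstock_Kurzweil_Integration.integral_combine[OF le g_sq_integrable_on]
      show ?case by (simp add: algebra_simps)
    qed
    from this[of N]
    have "integral {a..b} (\<lambda>u. (g u)\<^sup>2) \<le> g b * F b - g a * F a
       + S * (\<Sum>i<N. \<bar>g (t (Suc i)) - g (t i)\<bar>) + V * \<delta> * (var_upto b - var_upto a)"
      using that by (simp add: t_def \<delta>_def)
    moreover have "V * \<delta> * (var_upto b - var_upto a) \<le> V * \<delta> * V"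
      using \<delta> V_nonneg var_upto_le[of b] var_upto_nonneg[of a] by (intro mult_left_mono) auto
    moreover have "g b * F b \<le> S * \<bar>g b\<bar>" "- (g a * F a) \<le> S * \<bar>g a\<bar>"
      using mult_right_mono[OF S[of b], of "\<bar>g b\<bar>"] mult_right_mono[OF S[of a], of "\<bar>g a\<bar>"]
      by (simp_all flip: abs_mult add: mult.commute abs_le_iff)
    moreover have "S * (\<bar>g b\<bar> + \<bar>g a\<bar> + (\<Sum>i<N. \<bar>g (t (Suc i)) - g (t i)\<bar>)) \<le> S * (V + 2 * \<epsilon>)"
    proof (intro mult_left_mono S0)
      obtain c where c: "c \<le> a" "\<bar>g a\<bar> \<le> \<bar>g a - g c\<bar> + \<epsilon>" using tail_left \<open>0 < \<epsilon>\<close> by blast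
      obtain d where d: "b \<le> d" "\<bar>g b\<bar> \<le> \<bar>g b - g d\<bar> + \<epsilon>" using tail_right \<open>0 < \<epsilon>\<close> by blast
      \<comment> \<open>The partition with \<open>c\<close> put in front and \<open>d\<close> after
        it. The grid indices are shifted by one, so the last grid point has index
        \<open>Suc N\<close>.\<close>
      define r where "r = (\<lambda>i. if i = 0 then c else if i \<le> Suc N then t (i - 1) else d)"
      have tN: "t N = b" "t 0 = a" using that by (simp_all add: t_def \<delta>_def)
      have mt: "mono t" using \<delta> by (auto simp: mono_def t_def intro!: mult_right_mono)
      have "mono r" unfolding r_def
      proof (rule monoI)
        fix i j :: nat assume ij: "i \<le> j"
        have "t 0 \<le> t (j - 1)" using mt by (simp add: monoD)
        moreover have "t (i - 1) \<le> t N" if "i \<le> Suc N" using mt that by (intro monoD[OF mt]) auto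
        moreover have "t (i - 1) \<le> t (j - 1)" using ij by (intro monoD[OF mt]) auto
        ultimately show "(if i = 0 then c else if i \<le> Suc N then t (i - 1) else d) \<le>
          (if j = 0 then c else if j \<le> Suc N then t (j - 1) else d)"
          using ij c d tN assms(1) by auto
      qed
      from variation[OF this, of "Suc (Suc N)"]
      have "(\<Sum>i<Suc N. \<bar>g (r (Suc i)) - g (r i)\<bar>) + \<bar>g d - g b\<bar> \<le> V"
        using tN by (simp add: r_def)
      then have "\<bar>g a - g c\<bar> + (\<Sum>i<N. \<bar>g (t (Suc i)) - g (t i)\<bar>) + \<bar>g d - g b\<bar> \<le> V"
        using tN unfolding sum.lessThan_Suc_shift by (simp add: r_def)
      then show "\<bar>g b\<bar> + \<bar>g a\<bar> + (\<Sum>i<N. \<bar>g (t (Suc i)) - g (t i)\<bar>) \<le> V + 2 * \<epsilon>"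
        using c d by linarith
    qed
    ultimately show ?thesis by (simp add: algebra_simps \<delta>_def)
  qed
  \<comment> \<open>Taking \<epsilon> as \<open>1 / real N\<close> removes the tail error and the
    discretization error in one limit.\<close>
  have lim: "(\<lambda>N. S * (V + 2 * (1 / real N)) + V * V * ((b - a) / real N)) \<longlonglongrightarrow> S * (V + 2 * 0) + V * V * 0"
    by (intro tendsto_intros lim_1_over_n)
  have "\<forall>\<^sub>F N in sequentially. integral {a..b} (\<lambda>u. (g u)\<^sup>2) \<le>
      S * (V + 2 * (1 / real N)) + V * V * ((b - a) / real N)"
    using eventually_gt_at_top[of "0::nat"]
  proof eventually_elim
    case (elim N)
    then show ?case by (intro bound) auto
  qed
  then show ?thesis
    using tendsto_lowerbound[OF lim] by simp
qed

lemma nn_integral_g_sq_le: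
  assumes S: "\<And>x. \<bar>F x\<bar> \<le> S"
  shows "(\<integral>\<^sup>+x. ennreal ((g x)\<^sup>2) \<partial>lborel) \<le> ennreal (S * V)"
proof -
  \<comment> \<open>\<open>Suc n\<close> keeps every interval nondegenerate, as
    \<open>integral_g_sq_le\<close> asks for \<open>a < b\<close>.\<close>
  have "(\<integral>\<^sup>+x. ennreal ((g x)\<^sup>2) \<partial>lborel) =
    (\<integral>\<^sup>+x. (SUP n::nat. ennreal ((g x)\<^sup>2) * indicator {- real (Suc n)..real (Suc n)} x) \<partial>lborel)"
  proof (intro nn_integral_cong antisym)
    fix x :: real
    obtain n :: nat where "\<bar>x\<bar> \<le> real n" using real_arch_simple by blast
    then have "x \<in> {- real (Suc n)..real (Suc n)}" by (auto simp: abs_le_iff)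
    then show "ennreal ((g x)\<^sup>2) \<le> (SUP n::nat. ennreal ((g x)\<^sup>2) * indicator {- real (Suc n)..real (Suc n)} x)"
      by (intro SUP_upper2[of n]) auto
  qed (auto intro!: SUP_least simp: indicator_def)
  also have "\<dots> = (SUP n::nat. \<integral>\<^sup>+x. ennreal ((g x)\<^sup>2) * indicator {- real (Suc n)..real (Suc n)} x \<partial>lborel)"
    by (rule nn_integral_monotone_convergence_SUP)
      (auto simp: incseq_def le_fun_def indicator_def)
  also have "\<dots> \<le> ennreal (S * V)"
  proof (rule SUP_least)
    fix n :: nat
    have "(\<integral>\<^sup>+x. ennreal ((g x)\<^sup>2) * indicator {- real (Suc n)..real (Suc n)} x \<partial>lborel)
      = ennreal (LINT x:{- real (Suc n)..real (Suc n)}|lborel. (g x)\<^sup>2)"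
      unfolding set_lebesgue_integral_def
      by (subst nn_integral_eq_integral[symmetric])
        (use g_sq_set_integrable in \<open>auto simp: set_integrable_def indicator_def intro!: nn_integral_cong\<close>)
    also have "\<dots> = ennreal (integral {- real (Suc n)..real (Suc n)} (\<lambda>x. (g x)\<^sup>2))"
      by (subst set_borel_integral_eq_integral(2)[OF g_sq_set_integrable]) simp
    also have "\<dots> \<le> ennreal (S * V)"
      by (intro ennreal_leI integral_g_sq_le S) auto
    finally show "(\<integral>\<^sup>+x. ennreal ((g x)\<^sup>2) * indicator {- real (Suc n)..real (Suc n)} x \<partial>lborel) \<le> ennreal (S * V)" .
  qed
  finally show ?thesis .
qed

lemma second_derivative_roughness:
  "(\<integral>\<^sup>+x. ennreal ((g x)\<^sup>2) \<partial>lborel) \<le> ennreal (6 / (5 * pi) * V powr (5 / 3))"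
proof (cases "V = 0")
  case True
  then show ?thesis using abs_g_le by simp
next
  case False
  then have V: "0 < V" using V_nonneg by simp
  define c :: real where "c = 6 / (5 * pi)"
  \<comment> \<open>Machin's formula, with its second arctangent dropped, gives
    \<open>pi \<le> 16 / 5\<close>. Hence \<open>c\<close> is at least 3/8, whose cube 27/512
    exceeds 1/20.\<close>
  have "0 < arctan (1 / 239)" by simp
  moreover have "arctan (1 / 5) \<le> 1 / 5" by (rule arctan_le_self) simp
  ultimately have "pi \<le> 16 / 5" using machin by linarith
  then have "3 / 8 \<le> c" by (simp add: c_def field_simps)
  then have "(3 / 8) ^ 3 \<le> c ^ 3" by (intro power_mono) auto
  moreover have "(1 / 20 :: real) \<le> (3 / 8) ^ 3" by (simp add: power3_eq_cube)
  ultimately have c: "1 / 20 \<le> c ^ 3" "0 < c" by (linarith, simp add: c_def)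
  have "\<bar>F x\<bar> \<le> c * V powr (2 / 3)" for x
  proof (rule power_le_imp_le_base)
    have "(V powr (2 / 3)) ^ 3 = V\<^sup>2" using V by (simp add: powr_power)
    moreover have "1 / 20 * V\<^sup>2 \<le> c ^ 3 * V\<^sup>2" using c by (intro mult_right_mono) auto
    ultimately show "\<bar>F x\<bar> ^ Suc 2 \<le> (c * V powr (2 / 3)) ^ Suc 2"
      using abs_F_cubed_le[of x] by (simp add: power_mult_distrib)
  qed (use c in auto)
  from nn_integral_g_sq_le[OF this]
  have "(\<integral>\<^sup>+x. ennreal ((g x)\<^sup>2) \<partial>lborel) \<le> ennreal (c * V powr (2 / 3) * V)" .
  moreover have "V powr (2 / 3) * V = V powr (5 / 3)"
    using V powr_add[of V "2 / 3" 1] by simp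
  ultimately show ?thesis by (simp add: c_def mult.assoc)
qed

end

section \<open>Integrated squared bias\<close>

text \<open>The right-hand integral is extended real so that the lemma applies before its finiteness
  is known. In the finite case the inequality says that the weighted variance of \<open>f\<close> is
  nonnegative.\<close>

lemma weighted_cauchy_schwarz:
  fixes w f :: "'a \<Rightarrow> real"
  assumes w: "integrable M w" and [measurable]: "f \<in> borel_measurable M" and w0: "\<And>x. 0 \<le> w x"
  shows "ennreal ((LINT x|M. w x * f x)\<^sup>2) \<le>
    ennreal (LINT x|M. w x) * (\<integral>\<^sup>+x. ennreal (w x * (f x)\<^sup>2) \<partial>M)"
proof -
  have [measurable]: "w \<in> borel_measurable M" using w by auto
  define A where "A = (LINT x|M. w x)"
  define C where "C = (LINT x|M. w x * f x)"
  have "0 \<le> A" unfolding A_def using w0 by simp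
  show ?thesis
  proof (cases "A = 0")
    case True
    then have "AE x in M. w x = 0"
      using integral_nonneg_eq_0_iff_AE[OF w] w0 by (simp add: A_def)
    then have "C = (LINT x|M. 0)" unfolding C_def by (intro integral_cong_AE) auto
    then show ?thesis by (simp add: C_def)
  next
    case False
    with \<open>0 \<le> A\<close> have A: "0 < A" by simp
    show ?thesis
    proof (cases "(\<integral>\<^sup>+x. ennreal (w x * (f x)\<^sup>2) \<partial>M) = \<infinity>")
      case True
      then show ?thesis using A by (simp add: A_def ennreal_mult_top)
    next
      case False
      have wff: "integrable M (\<lambda>x. w x * (f x)\<^sup>2)"
        by (rule integrableI_nonneg) (use False w0 in \<open>auto simp: less_top\<close>)
      have wf: "integrable M (\<lambda>x. w x * f x)"
      proof (rule Bochner_Integration.integrable_bound[OF Bochner_Integration.integrable_add[OF w wff]])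
        have "\<bar>f x\<bar> \<le> 1 + (f x)\<^sup>2" for x
          using zero_le_power2[of "\<bar>f x\<bar> - 1"] zero_le_power2[of "f x"]
          by (simp add: power2_eq_square algebra_simps flip: abs_mult)
        then have "w x * \<bar>f x\<bar> \<le> w x * (1 + (f x)\<^sup>2)" for x by (intro mult_left_mono w0)
        then show "AE x in M. norm (w x * f x) \<le> norm (w x + w x * (f x)\<^sup>2)"
          using w0 by (auto simp: abs_mult algebra_simps)
      qed auto
      define B where "B = (LINT x|M. w x * (f x)\<^sup>2)"
      have "0 \<le> (LINT x|M. w x * (f x - C / A)\<^sup>2)" using w0 by simp
      also have "\<dots> = (LINT x|M. w x * (f x)\<^sup>2 - 2 * (C / A) * (w x * f x) + (C / A)\<^sup>2 * w x)"
        by (rule Bochner_Integration.integral_cong) (auto simp: power2_eq_square algebra_simps)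
      also have "\<dots> = B - 2 * (C / A) * C + (C / A)\<^sup>2 * A"
        using w wf wff by (simp add: A_def B_def C_def)
      also have "\<dots> = B - C\<^sup>2 / A" using A by (simp add: power2_eq_square field_simps)
      finally have "C\<^sup>2 \<le> A * B" using A by (simp add: field_simps)
      then have "ennreal (C\<^sup>2) \<le> ennreal A * ennreal B"
        using A by (simp add: ennreal_leI flip: ennreal_mult')
      also have "ennreal B = (\<integral>\<^sup>+x. ennreal (w x * (f x)\<^sup>2) \<partial>M)"
        unfolding B_def using w0 by (subst nn_integral_eq_integral[OF wff]) auto
      finally show ?thesis by (simp add: A_def C_def)
    qed
  qed
qed

lemma nn_integral_lborel_translate:
  fixes f :: "real \<Rightarrow> ennreal"
  assumes [measurable]: "f \<in> borel_measurable borel"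
  shows "(\<integral>\<^sup>+x. f (x + c) \<partial>lborel) = (\<integral>\<^sup>+x. f x \<partial>lborel)"
  using nn_integral_real_affine[of f 1 c] by (simp add: add.commute)

lemma ennreal_mult_left_assoc: "0 \<le> a \<Longrightarrow> ennreal a * (ennreal b * x) = ennreal (a * b) * x"
  by (simp add: ennreal_mult' mult.assoc)

context bv_density
begin

definition taylor_rem :: "real \<Rightarrow> real \<Rightarrow> real" where
  "taylor_rem x d = p (x + d) - p x - d * F x"

lemma measurable_taylor_rem [measurable (raw)]:
  assumes [measurable]: "f \<in> borel_measurable M" "h \<in> borel_measurable M"
  shows "(\<lambda>x. taylor_rem (f x) (h x)) \<in> borel_measurable M"
  unfolding taylor_rem_def by measurable

lemma taylor_rem_0 [simp]: "taylor_rem x 0 = 0"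
  by (simp add: taylor_rem_def)

lemma abs_taylor_rem_le: "\<bar>taylor_rem x d\<bar> \<le> d\<^sup>2 * V"
proof -
  obtain \<xi> where "p (x + d) = p x + F x * (x + d - x) + g \<xi> * (x + d - x)\<^sup>2 / 2"
    using taylor_two by metis
  then have "\<bar>taylor_rem x d\<bar> = d\<^sup>2 * \<bar>g \<xi> / 2\<bar>" by (simp add: taylor_rem_def abs_mult)
  also have "\<dots> \<le> d\<^sup>2 * V" using abs_g_le[of \<xi>] by (intro mult_left_mono) auto
  finally show ?thesis .
qed

text \<open>Rescaling the remainder integral to the unit interval makes the weight
  \<open>1 - s\<close> independent of \<open>x\<close> and \<open>d\<close>, as the later exchange
  of integrals requires.\<close>

lemma taylor_rem_eq_integral: "taylor_rem x d = d\<^sup>2 * (LINT s|lborel. indicator {0..1} s * (1 - s) * g (x + s * d))"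
proof -
  \<comment> \<open>The first-order Taylor expansion about \<open>x + s * d\<close>, evaluated at
    \<open>x + d\<close>. Moving the base point from \<open>x\<close> to \<open>x + d\<close>
    changes it by exactly the remainder, and the terms with \<open>F\<close> cancel in its
    derivative.\<close>
  define \<phi> where "\<phi> s = (1 - s) * d * F (x + s * d) + p (x + s * d)" for s
  have "(\<phi> has_real_derivative (1 - s) * d\<^sup>2 * g (x + s * d)) (at s)" for s
    unfolding \<phi>_def
    by (auto intro!: derivative_eq_intros DERIV_chain2[OF F_deriv] DERIV_chain2[OF p_deriv]
      simp: power2_eq_square algebra_simps)
  then have 1: "((\<lambda>s. (1 - s) * d\<^sup>2 * g (x + s * d)) has_integral \<phi> 1 - \<phi> 0) {0..1}"
    by (intro fundamental_theorem_of_calculus)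
      (auto simp flip: has_real_derivative_iff_has_vector_derivative intro: has_field_derivative_at_within)
  have 2: "set_integrable lborel {0..1} (\<lambda>s. (1 - s) * d\<^sup>2 * g (x + s * d))"
  proof (rule set_integrable_bound[of lborel _ "\<lambda>_. d\<^sup>2 * V"])
    show "AE s in lborel. s \<in> {0..1} \<longrightarrow> norm ((1 - s) * d\<^sup>2 * g (x + s * d)) \<le> norm (d\<^sup>2 * V)"
    proof (intro AE_I2 impI)
      fix s :: real assume "s \<in> {0..1}"
      then have "\<bar>1 - s\<bar> * d\<^sup>2 * \<bar>g (x + s * d)\<bar> \<le> 1 * d\<^sup>2 * V"
        by (intro mult_mono abs_g_le) auto
      then show "norm ((1 - s) * d\<^sup>2 * g (x + s * d)) \<le> norm (d\<^sup>2 * V)"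
        using V_nonneg by (simp add: abs_mult)
    qed
  qed (auto simp: set_borel_measurable_def intro: borel_integrable_atLeastAtMost')
  have "taylor_rem x d = \<phi> 1 - \<phi> 0" by (simp add: \<phi>_def taylor_rem_def)
  also have "\<dots> = (LINT s:{0..1}|lborel. (1 - s) * d\<^sup>2 * g (x + s * d))"
    using integral_unique[OF 1] set_borel_integral_eq_integral(2)[OF 2] by simp
  also have "\<dots> = (LINT s|lborel. d\<^sup>2 * (indicator {0..1} s * (1 - s) * g (x + s * d)))"
    unfolding set_lebesgue_integral_def by (intro Bochner_Integration.integral_cong) auto
  finally show ?thesis by simp
qed

text \<open>The weight \<open>1 - s\<close> has mass 1/2, which enters once through Cauchy-Schwarz
  and once when \<open>s\<close> is integrated out; hence 1/4. In between, translation invariance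
  removes \<open>s * d\<close> from the argument of \<open>g\<close>.\<close>

lemma nn_integral_taylor_rem_sq:
  "(\<integral>\<^sup>+x. ennreal ((taylor_rem x d)\<^sup>2) \<partial>lborel) \<le> ennreal (d ^ 4 / 4) * (\<integral>\<^sup>+x. ennreal ((g x)\<^sup>2) \<partial>lborel)"
proof -
  define w where "w s = indicator {0..1} s * (1 - s)" for s :: real
  have [measurable]: "w \<in> borel_measurable borel" unfolding w_def[abs_def] by measurable
  have w0: "0 \<le> w s" for s by (simp add: w_def indicator_def)
  have w_int: "set_integrable lborel {0..1} (\<lambda>s::real. 1 - s)"
    by (intro borel_integrable_atLeastAtMost' continuous_intros)
  have w: "integrable lborel w"
    using w_int by (simp add: set_integrable_def w_def[abs_def])
  have "((\<lambda>s::real. 1 - s) has_integral (1 - 1\<^sup>2 / 2) - (0 - 0\<^sup>2 / 2)) {0..1}"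
    by (intro fundamental_theorem_of_calculus)
      (auto simp flip: has_real_derivative_iff_has_vector_derivative intro!: derivative_eq_intros)
  then have "(LINT s:{0..1}|lborel. 1 - s) = (1 / 2 :: real)"
    using set_borel_integral_eq_integral(2)[OF w_int] by (simp add: integral_unique)
  then have w2: "(LINT s|lborel. w s) = 1 / 2"
    by (simp add: set_lebesgue_integral_def w_def[abs_def])
  have "ennreal ((taylor_rem x d)\<^sup>2) \<le> ennreal (d ^ 4 / 2) * (\<integral>\<^sup>+s. ennreal (w s * (g (x + s * d))\<^sup>2) \<partial>lborel)" for x
  proof -
    have "ennreal ((taylor_rem x d)\<^sup>2) = ennreal (d ^ 4) * ennreal ((LINT s|lborel. w s * g (x + s * d))\<^sup>2)"
      by (subst taylor_rem_eq_integral)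
        (simp add: w_def power_mult_distrib flip: ennreal_mult' power_mult)
    also have "\<dots> \<le> ennreal (d ^ 4) * (ennreal (1 / 2) * (\<integral>\<^sup>+s. ennreal (w s * (g (x + s * d))\<^sup>2) \<partial>lborel))"
      using weighted_cauchy_schwarz[OF w, of "\<lambda>s. g (x + s * d)"] w0 w2
      by (intro mult_left_mono) auto
    also have "\<dots> = ennreal (d ^ 4 / 2) * (\<integral>\<^sup>+s. ennreal (w s * (g (x + s * d))\<^sup>2) \<partial>lborel)"
      by (subst ennreal_mult_left_assoc) simp_all
    finally show ?thesis .
  qed
  then have "(\<integral>\<^sup>+x. ennreal ((taylor_rem x d)\<^sup>2) \<partial>lborel) \<le>
      (\<integral>\<^sup>+x. ennreal (d ^ 4 / 2) * (\<integral>\<^sup>+s. ennreal (w s * (g (x + s * d))\<^sup>2) \<partial>lborel) \<partial>lborel)"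
    by (intro nn_integral_mono)
  also have "\<dots> = ennreal (d ^ 4 / 2) * (\<integral>\<^sup>+x. (\<integral>\<^sup>+s. ennreal (w s * (g (x + s * d))\<^sup>2) \<partial>lborel) \<partial>lborel)"
    by (rule nn_integral_cmult) measurable
  also have "(\<integral>\<^sup>+x. (\<integral>\<^sup>+s. ennreal (w s * (g (x + s * d))\<^sup>2) \<partial>lborel) \<partial>lborel) =
      (\<integral>\<^sup>+s. (\<integral>\<^sup>+x. ennreal (w s * (g (x + s * d))\<^sup>2) \<partial>lborel) \<partial>lborel)"
    by (rule lborel_pair.Fubini'[symmetric]) measurable
  also have "\<dots> = (\<integral>\<^sup>+s. ennreal (w s) * (\<integral>\<^sup>+x. ennreal ((g x)\<^sup>2) \<partial>lborel) \<partial>lborel)"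
  proof (rule nn_integral_cong)
    fix s :: real
    have "(\<integral>\<^sup>+x. ennreal (w s * (g (x + s * d))\<^sup>2) \<partial>lborel) = ennreal (w s) * (\<integral>\<^sup>+x. ennreal ((g (x + s * d))\<^sup>2) \<partial>lborel)"
      using w0 by (simp add: ennreal_mult' nn_integral_cmult)
    then show "(\<integral>\<^sup>+x. ennreal (w s * (g (x + s * d))\<^sup>2) \<partial>lborel) = ennreal (w s) * (\<integral>\<^sup>+x. ennreal ((g x)\<^sup>2) \<partial>lborel)"
      using nn_integral_lborel_translate[of "\<lambda>x. ennreal ((g x)\<^sup>2)" "s * d"] by simp
  qed
  also have "\<dots> = (\<integral>\<^sup>+s. ennreal (w s) \<partial>lborel) * (\<integral>\<^sup>+x. ennreal ((g x)\<^sup>2) \<partial>lborel)"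
    by (rule nn_integral_multc) measurable
  also have "(\<integral>\<^sup>+s. ennreal (w s) \<partial>lborel) = ennreal (1 / 2)"
    using w0 by (subst nn_integral_eq_integral[OF w]) (auto simp: w2)
  also have "ennreal (d ^ 4 / 2) * (ennreal (1 / 2) * (\<integral>\<^sup>+x. ennreal ((g x)\<^sup>2) \<partial>lborel)) =
      ennreal (d ^ 4 / 4) * (\<integral>\<^sup>+x. ennreal ((g x)\<^sup>2) \<partial>lborel)"
    by (subst ennreal_mult_left_assoc) simp_all
  finally show ?thesis .
qed

end

section \<open>Centered kernels and the bias of smoothing\<close>

locale centered_kernel =
  fixes K :: "real \<Rightarrow> real"
  assumes density: "prob_density K"
    and moment2: "integrable lborel (\<lambda>x. \<bar>x\<bar> ^ 2 * K x)"
    and centered: "(LINT x|lborel. x * K x) = 0"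
begin

lemma measurable_K [measurable]: "K \<in> borel_measurable borel"
  using density by (simp add: prob_density_def)

lemma K_nonneg: "0 \<le> K x"
  using density by (simp add: prob_density_def)

lemma integrable_K: "integrable lborel K"
  by (rule integrableI_nonneg) (use density in \<open>auto simp: prob_density_def\<close>)

lemma integral_K: "(LINT x|lborel. K x) = 1"
  using density by (subst integral_eq_nn_integral) (auto simp: prob_density_def)

lemma integrable_moment1: "integrable lborel (\<lambda>x. x * K x)"
proof (rule Bochner_Integration.integrable_bound[OF Bochner_Integration.integrable_add[OF integrable_K moment2]])
  have "\<bar>x\<bar> \<le> 1 + \<bar>x\<bar> ^ 2" for x :: real
    using zero_le_power2[of "\<bar>x\<bar> - 1"] abs_ge_zero[of x]
    unfolding power2_diff by simp
  then have "\<bar>x\<bar> * K x \<le> (1 + \<bar>x\<bar> ^ 2) * K x" for x by (intro mult_right_mono K_nonneg)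
  then show "AE x in lborel. norm (x * K x) \<le> norm (K x + \<bar>x\<bar> ^ 2 * K x)"
    using K_nonneg by (auto simp: abs_mult algebra_simps)
qed auto

end

locale smoothing = bv_density p F g V + centered_kernel K
  for p F g V K
begin

lemma integrable_K_taylor_rem: "integrable lborel (\<lambda>u. K u * taylor_rem x (- (h * u)))"
proof (rule Bochner_Integration.integrable_bound[OF integrable_mult_right[OF moment2, of "h\<^sup>2 * V"]])
  have "K u * \<bar>taylor_rem x (- (h * u))\<bar> \<le> K u * ((- (h * u))\<^sup>2 * V)" for u
    by (intro mult_left_mono K_nonneg abs_taylor_rem_le)
  then show "AE u in lborel. norm (K u * taylor_rem x (- (h * u))) \<le> norm (h\<^sup>2 * V * (\<bar>u\<bar> ^ 2 * K u))"
    using K_nonneg V_nonneg by (auto simp: abs_mult power_mult_distrib ac_simps)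
qed measurable

lemma K_p_eq: "K u * p (x - h * u) = p x * K u - h * F x * (u * K u) + K u * taylor_rem x (- (h * u))"
  by (simp add: taylor_rem_def algebra_simps)

text \<open>Unit mass of \<open>K\<close> cancels \<open>p x\<close> and centering cancels the slope
  term, so only the second-order remainder is left.\<close>

lemma bias_eq: "(LINT u|lborel. K u * p (x - h * u)) - p x = (LINT u|lborel. K u * taylor_rem x (- (h * u)))"
  unfolding K_p_eq using integrable_K integrable_moment1 integrable_K_taylor_rem
  by (simp add: integral_K centered)

text \<open>Cauchy-Schwarz is applied with the weight \<open>\<bar>u\<bar> ^ 2 * K u\<close>, whose
  mass is the second moment. The division by the square of \<open>u\<close> offsets the growth of
  the remainder, so each slice in \<open>u\<close> has the same bound. The second moment appears
  squared: once from Cauchy-Schwarz, once from integrating the weight.\<close>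

lemma integrated_squared_bias:
  "(\<integral>\<^sup>+x. ennreal (((LINT u|lborel. K u * p (x - h * u)) - p x)\<^sup>2) \<partial>lborel) \<le>
    ennreal (h ^ 4 / 4 * (abs_moment 2 K)\<^sup>2) * (\<integral>\<^sup>+x. ennreal ((g x)\<^sup>2) \<partial>lborel)" (is "?L \<le> _ * ?G")
proof -
  define \<mu> where "\<mu> = abs_moment 2 K"
  define w where "w u = \<bar>u\<bar> ^ 2 * K u" for u
  have [measurable]: "w \<in> borel_measurable borel" unfolding w_def[abs_def] by measurable
  have w: "integrable lborel w" "(LINT u|lborel. w u) = \<mu>" "\<And>u. 0 \<le> w u"
    using moment2 K_nonneg by (auto simp: w_def[abs_def] \<mu>_def abs_moment_def)
  have \<mu>: "0 \<le> \<mu>" unfolding w(2)[symmetric] using w(3) by (rule Bochner_Integration.integral_nonneg)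
  have "ennreal (((LINT u|lborel. K u * p (x - h * u)) - p x)\<^sup>2) \<le>
    ennreal \<mu> * (\<integral>\<^sup>+u. ennreal (w u * (taylor_rem x (- (h * u)) / u\<^sup>2)\<^sup>2) \<partial>lborel)" for x
  proof -
    have "(LINT u|lborel. K u * taylor_rem x (- (h * u))) = (LINT u|lborel. w u * (taylor_rem x (- (h * u)) / u\<^sup>2))"
    proof (rule Bochner_Integration.integral_cong)
      fix u :: real
      \<comment> \<open>At \<open>u = 0\<close> both sides vanish: the remainder on the left, the
        weight on the right.\<close>
      show "K u * taylor_rem x (- (h * u)) = w u * (taylor_rem x (- (h * u)) / u\<^sup>2)"
        by (cases "u = 0") (auto simp: w_def)
    qed simp
    then show ?thesis unfolding bias_eq
      using weighted_cauchy_schwarz[OF w(1), of "\<lambda>u. taylor_rem x (- (h * u)) / u\<^sup>2"] w by simp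
  qed
  then have "?L \<le> (\<integral>\<^sup>+x. ennreal \<mu> * (\<integral>\<^sup>+u. ennreal (w u * (taylor_rem x (- (h * u)) / u\<^sup>2)\<^sup>2) \<partial>lborel) \<partial>lborel)"
    by (intro nn_integral_mono)
  also have "\<dots> = ennreal \<mu> * (\<integral>\<^sup>+x. (\<integral>\<^sup>+u. ennreal (w u * (taylor_rem x (- (h * u)) / u\<^sup>2)\<^sup>2) \<partial>lborel) \<partial>lborel)"
    by (rule nn_integral_cmult) measurable
  also have "(\<integral>\<^sup>+x. (\<integral>\<^sup>+u. ennreal (w u * (taylor_rem x (- (h * u)) / u\<^sup>2)\<^sup>2) \<partial>lborel) \<partial>lborel) =
     (\<integral>\<^sup>+u. (\<integral>\<^sup>+x. ennreal (w u * (taylor_rem x (- (h * u)) / u\<^sup>2)\<^sup>2) \<partial>lborel) \<partial>lborel)"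
    by (rule lborel_pair.Fubini'[symmetric]) measurable
  also have "\<dots> \<le> (\<integral>\<^sup>+u. ennreal (w u) * (ennreal (h ^ 4 / 4) * ?G) \<partial>lborel)"
  proof (rule nn_integral_mono)
    fix u :: real
    show "(\<integral>\<^sup>+x. ennreal (w u * (taylor_rem x (- (h * u)) / u\<^sup>2)\<^sup>2) \<partial>lborel) \<le> ennreal (w u) * (ennreal (h ^ 4 / 4) * ?G)"
    proof (cases "u = 0")
      case False
      have "(\<integral>\<^sup>+x. ennreal (w u * (taylor_rem x (- (h * u)) / u\<^sup>2)\<^sup>2) \<partial>lborel) =
        (\<integral>\<^sup>+x. ennreal (w u / u ^ 4) * ennreal ((taylor_rem x (- (h * u)))\<^sup>2) \<partial>lborel)"
        using w(3)[of u] by (intro nn_integral_cong) (simp add: power_divide flip: ennreal_mult' power_mult)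
      also have "\<dots> = ennreal (w u / u ^ 4) * (\<integral>\<^sup>+x. ennreal ((taylor_rem x (- (h * u)))\<^sup>2) \<partial>lborel)"
        by (rule nn_integral_cmult) measurable
      also have "\<dots> \<le> ennreal (w u / u ^ 4) * (ennreal ((- (h * u)) ^ 4 / 4) * ?G)"
        by (intro mult_left_mono nn_integral_taylor_rem_sq) auto
      also have "\<dots> = ennreal (w u) * (ennreal (h ^ 4 / 4) * ?G)"
        using False w(3)[of u] by (simp add: ennreal_mult_left_assoc power_mult_distrib)
      finally show ?thesis .
    qed (simp add: w_def)
  qed
  also have "\<dots> = (\<integral>\<^sup>+u. ennreal (w u) \<partial>lborel) * (ennreal (h ^ 4 / 4) * ?G)"
    by (rule nn_integral_multc) measurable
  also have "(\<integral>\<^sup>+u. ennreal (w u) \<partial>lborel) = ennreal \<mu>"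
    using w by (subst nn_integral_eq_integral) auto
  also have "ennreal \<mu> * (ennreal \<mu> * (ennreal (h ^ 4 / 4) * ?G)) = ennreal (\<mu> * (\<mu> * (h ^ 4 / 4))) * ?G"
    by (simp only: ennreal_mult_left_assoc[OF \<mu>])
  also have "\<mu> * (\<mu> * (h ^ 4 / 4)) = h ^ 4 / 4 * \<mu>\<^sup>2"
    by (simp add: power2_eq_square)
  finally show ?thesis by (simp add: \<mu>_def mult_left_mono)
qed

end

section \<open>Variance and integrated mean squared error\<close>

text \<open>Off-diagonal products have expectation 0 by independence and centering, so only the
  squares survive.\<close>

lemma (in prob_space) expectation_square_sum_indep:
  fixes Z :: "'i \<Rightarrow> 'a \<Rightarrow> real"
  assumes "finite I" and indep: "indep_vars (\<lambda>_. borel) Z I"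
    and sq: "\<And>i. i \<in> I \<Longrightarrow> integrable M (\<lambda>\<omega>. (Z i \<omega>)\<^sup>2)"
    and mean: "\<And>i. i \<in> I \<Longrightarrow> expectation (Z i) = 0"
  shows "integrable M (\<lambda>\<omega>. (\<Sum>i\<in>I. Z i \<omega>)\<^sup>2)"
    and "expectation (\<lambda>\<omega>. (\<Sum>i\<in>I. Z i \<omega>)\<^sup>2) = (\<Sum>i\<in>I. expectation (\<lambda>\<omega>. (Z i \<omega>)\<^sup>2))"
proof -
  have meas [measurable]: "Z i \<in> borel_measurable M" if "i \<in> I" for i
    using indep that by (auto simp: indep_vars_def)
  have int: "integrable M (Z i)" if "i \<in> I" for i
    using square_integrable_imp_integrable[OF meas[OF that] sq[OF that]] .
  have pair: "integrable M (\<lambda>\<omega>. Z i \<omega> * Z j \<omega>) \<and>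
      expectation (\<lambda>\<omega>. Z i \<omega> * Z j \<omega>) = (if i = j then expectation (\<lambda>\<omega>. (Z i \<omega>)\<^sup>2) else 0)"
    if ij: "i \<in> I" "j \<in> I" for i j
  proof (cases "i = j")
    case True
    then show ?thesis using sq[OF ij(1)] by (simp add: power2_eq_square)
  next
    case False
    have ind: "indep_vars (\<lambda>_. borel) Z {i, j}"
      by (rule indep_vars_subset[OF indep]) (use ij in auto)
    show ?thesis
      using indep_vars_lebesgue_integral[OF _ ind] indep_vars_integrable[OF _ ind] int ij mean False
      by auto
  qed
  have eq: "(\<Sum>i\<in>I. Z i \<omega>)\<^sup>2 = (\<Sum>i\<in>I. \<Sum>j\<in>I. Z i \<omega> * Z j \<omega>)" for \<omega>
    by (simp add: power2_eq_square sum_product)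
  show "integrable M (\<lambda>\<omega>. (\<Sum>i\<in>I. Z i \<omega>)\<^sup>2)"
    unfolding eq using pair by (intro Bochner_Integration.integrable_sum) auto
  have "expectation (\<lambda>\<omega>. (\<Sum>i\<in>I. Z i \<omega>)\<^sup>2) = (\<Sum>i\<in>I. \<Sum>j\<in>I. expectation (\<lambda>\<omega>. Z i \<omega> * Z j \<omega>))"
    unfolding eq using pair
    by (subst Bochner_Integration.integral_sum; intro sum.cong Bochner_Integration.integral_sum
        Bochner_Integration.integrable_sum) auto
  also have "\<dots> = (\<Sum>i\<in>I. \<Sum>j\<in>I. if i = j then expectation (\<lambda>\<omega>. (Z i \<omega>)\<^sup>2) else 0)"
    using pair by (intro sum.cong) auto
  finally show "expectation (\<lambda>\<omega>. (\<Sum>i\<in>I. Z i \<omega>)\<^sup>2) = (\<Sum>i\<in>I. expectation (\<lambda>\<omega>. (Z i \<omega>)\<^sup>2))"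
    using \<open>finite I\<close> by simp
qed

text \<open>Variance plus squared bias, with the variance of one term bounded by its second moment.
  That moment \<open>s\<close> is extended real, because for the kernel estimator it is not known to
  be finite at every point.\<close>

lemma (in prob_space) mean_squared_error_le:
  fixes Y :: "nat \<Rightarrow> 'a \<Rightarrow> real"
  assumes n: "1 \<le> n" and indep: "indep_vars (\<lambda>_. borel) Y {1..n}"
    and sq: "\<And>j. j \<in> {1..n} \<Longrightarrow> (\<integral>\<^sup>+\<omega>. ennreal ((Y j \<omega>)\<^sup>2) \<partial>M) = s"
    and mean: "\<And>j. j \<in> {1..n} \<Longrightarrow> expectation (Y j) = m"
  shows "(\<integral>\<^sup>+\<omega>. ennreal (((\<Sum>j=1..n. Y j \<omega>) / real n - c)\<^sup>2) \<partial>M) \<le> ennreal (1 / real n) * s + ennreal ((m - c)\<^sup>2)"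
proof (cases "s = \<infinity>")
  case True
  then show ?thesis using n by (simp add: ennreal_mult_top)
next
  case False
  have meas [measurable]: "Y j \<in> borel_measurable M" if "j \<in> {1..n}" for j
    using indep that by (auto simp: indep_vars_def)
  have Y2: "integrable M (\<lambda>\<omega>. (Y j \<omega>)\<^sup>2)" if "j \<in> {1..n}" for j
    by (rule integrableI_nonneg) (use meas[OF that] sq[OF that] False in \<open>auto simp: less_top\<close>)
  have Y1: "integrable M (Y j)" if "j \<in> {1..n}" for j
    using square_integrable_imp_integrable[OF meas[OF that] Y2[OF that]] .
  have s: "ennreal (expectation (\<lambda>\<omega>. (Y j \<omega>)\<^sup>2)) = s" if "j \<in> {1..n}" for j
    using nn_integral_eq_integral[OF Y2[OF that]] sq[OF that] by simp
  define Z where "Z j \<omega> = Y j \<omega> - m" for j \<omega>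
  have Zeq: "Z j = (\<lambda>\<omega>. Y j \<omega> - m)" for j by (simp add: Z_def[abs_def])
  have indepZ: "indep_vars (\<lambda>_. borel) Z {1..n}"
    unfolding Zeq[abs_def] by (rule indep_vars_compose2[OF indep]) auto
  have Z1: "integrable M (Z j)" "expectation (Z j) = 0" if "j \<in> {1..n}" for j
    using Y1[OF that] mean[OF that] by (auto simp: Zeq prob_space)
  have Z2: "integrable M (\<lambda>\<omega>. (Z j \<omega>)\<^sup>2)" if "j \<in> {1..n}" for j
    using Y1[OF that] Y2[OF that] by (simp add: Z_def power2_diff)
  have Z2le: "expectation (\<lambda>\<omega>. (Z j \<omega>)\<^sup>2) \<le> enn2real s" if "j \<in> {1..n}" for j
  proof -
    have "expectation (\<lambda>\<omega>. (Z j \<omega>)\<^sup>2) = expectation (\<lambda>\<omega>. (Y j \<omega>)\<^sup>2) - m\<^sup>2"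
      using Y1[OF that] Y2[OF that] mean[OF that]
      by (simp add: Z_def power2_diff prob_space) (simp add: power2_eq_square)
    also have "\<dots> \<le> expectation (\<lambda>\<omega>. (Y j \<omega>)\<^sup>2)" by simp
    also have "\<dots> = enn2real s" by (simp flip: s[OF that])
    finally show ?thesis .
  qed
  define S where "S \<omega> = (\<Sum>j=1..n. Z j \<omega>)" for \<omega>
  have S2: "integrable M (\<lambda>\<omega>. (S \<omega>)\<^sup>2)"
    "expectation (\<lambda>\<omega>. (S \<omega>)\<^sup>2) = (\<Sum>j=1..n. expectation (\<lambda>\<omega>. (Z j \<omega>)\<^sup>2))"
    unfolding S_def using expectation_square_sum_indep[OF _ indepZ] Z1 Z2 by auto
  have S1: "integrable M S" "expectation S = 0"
    unfolding S_def[abs_def] using Z1 by (auto simp: Bochner_Integration.integral_sum)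
  have square: "(a / b + d)\<^sup>2 = 1 / b\<^sup>2 * a\<^sup>2 + 2 * d / b * a + d\<^sup>2" for a b d :: real
    by (simp add: power2_sum power_divide)
  \<comment> \<open>Deviation from the mean plus bias; the middle term vanishes in expectation
    because \<open>S\<close> is centered.\<close>
  have eq: "((\<Sum>j=1..n. Y j \<omega>) / real n - c)\<^sup>2 =
      1 / (real n)\<^sup>2 * (S \<omega>)\<^sup>2 + 2 * (m - c) / real n * S \<omega> + (m - c)\<^sup>2" for \<omega>
  proof -
    have "(\<Sum>j=1..n. Y j \<omega>) / real n - c = S \<omega> / real n + (m - c)"
      using n by (simp add: S_def Z_def sum_subtractf field_simps)
    then show ?thesis by (simp only: square)
  qed
  have int: "integrable M (\<lambda>\<omega>. ((\<Sum>j=1..n. Y j \<omega>) / real n - c)\<^sup>2)"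
    unfolding eq using S1 S2 by simp
  have "expectation (\<lambda>\<omega>. ((\<Sum>j=1..n. Y j \<omega>) / real n - c)\<^sup>2) = 1 / (real n)\<^sup>2 * expectation (\<lambda>\<omega>. (S \<omega>)\<^sup>2) + (m - c)\<^sup>2"
    unfolding eq using S1 S2 by (simp add: prob_space)
  also have "expectation (\<lambda>\<omega>. (S \<omega>)\<^sup>2) \<le> real n * enn2real s"
    unfolding S2(2) using sum_bounded_above[of "{1..n}" "\<lambda>j. expectation (\<lambda>\<omega>. (Z j \<omega>)\<^sup>2)"] Z2le by simp
  then have "1 / (real n)\<^sup>2 * expectation (\<lambda>\<omega>. (S \<omega>)\<^sup>2) + (m - c)\<^sup>2 \<le>
      1 / (real n)\<^sup>2 * (real n * enn2real s) + (m - c)\<^sup>2"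
    by (intro add_right_mono mult_left_mono) auto
  also have "\<dots> = 1 / real n * enn2real s + (m - c)\<^sup>2"
    using n by (simp add: power2_eq_square)
  finally have "expectation (\<lambda>\<omega>. ((\<Sum>j=1..n. Y j \<omega>) / real n - c)\<^sup>2) \<le> 1 / real n * enn2real s + (m - c)\<^sup>2" .
  note bound = ennreal_leI[OF this]
  have "(\<integral>\<^sup>+\<omega>. ennreal (((\<Sum>j=1..n. Y j \<omega>) / real n - c)\<^sup>2) \<partial>M) =
      ennreal (expectation (\<lambda>\<omega>. ((\<Sum>j=1..n. Y j \<omega>) / real n - c)\<^sup>2))"
    by (rule nn_integral_eq_integral[OF int]) simp
  also have "\<dots> \<le> ennreal (1 / real n * enn2real s + (m - c)\<^sup>2)" by (rule bound)
  also have "\<dots> = ennreal (1 / real n) * ennreal (enn2real s) + ennreal ((m - c)\<^sup>2)"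
    by (simp flip: ennreal_mult')
  also have "ennreal (enn2real s) = s" using False by (simp add: less_top)
  finally show ?thesis .
qed

context smoothing
begin

text \<open>Tonelli's theorem moves the expectation inside, where the pointwise decomposition
  applies. Its variance part is then integrated exactly and its bias part is bounded by
  \<open>integrated_squared_bias\<close>.\<close>

lemma mise_kernel_estimator_le:
  fixes X :: "nat \<Rightarrow> 'a \<Rightarrow> real"
  assumes M: "prob_space M" and n: "1 \<le> n" and indep: "prob_space.indep_vars M (\<lambda>_. borel) X {1..n}"
    and X: "\<And>j. j \<in> {1..n} \<Longrightarrow> distributed M lborel (X j) (\<lambda>x. ennreal (p x))"
    and K2: "integrable lborel (\<lambda>x. (K x)\<^sup>2)" and h: "0 < h"
  shows "MISE M (kernel_estimator K X n h) p \<le>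
    ennreal (roughness K / (real n * h)) +
    ennreal (h ^ 4 / 4 * (abs_moment 2 K)\<^sup>2) * (\<integral>\<^sup>+x. ennreal ((g x)\<^sup>2) \<partial>lborel)"
proof -
  interpret prob_space M by (rule M)
  interpret pair: pair_sigma_finite M lborel ..
  have Xm [measurable]: "X j \<in> borel_measurable M" if "j \<in> {1..n}" for j
    using distributed_measurable[OF X[OF that]] by simp
  define s where "s x = (\<integral>\<^sup>+y. ennreal (p y) * ennreal ((scaled_kernel K h (x - y))\<^sup>2) \<partial>lborel)" for x
  define m where "m x = (LINT u|lborel. K u * p (x - h * u))" for x
  have [measurable]: "scaled_kernel K h \<in> borel_measurable borel"
    unfolding scaled_kernel_def[abs_def] by measurable
  have [measurable]: "s \<in> borel_measurable borel" unfolding s_def[abs_def] by measurable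
  have [measurable]: "m \<in> borel_measurable borel" unfolding m_def[abs_def] by measurable
  have mean: "expectation (\<lambda>\<omega>. scaled_kernel K h (x - X j \<omega>)) = m x" if "j \<in> {1..n}" for x j
  proof -
    have "expectation (\<lambda>\<omega>. scaled_kernel K h (x - X j \<omega>)) = (LINT y|lborel. p y * scaled_kernel K h (x - y))"
      by (rule distributed_integral[OF X[OF that], symmetric]) (auto simp: p_nonneg)
    \<comment> \<open>Substitution of \<open>x - h * u\<close> for \<open>y\<close>.\<close>
    also have "\<dots> = h * (LINT u|lborel. p (x - h * u) * (K u / h))"
      using lborel_integral_real_affine[of "- h" "\<lambda>y. p y * scaled_kernel K h (x - y)" x] h
      by (simp add: scaled_kernel_def)
    also have "\<dots> = m x" using h by (simp add: m_def mult.commute)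
    finally show ?thesis .
  qed
  have pointwise: "(\<integral>\<^sup>+\<omega>. ennreal ((kernel_estimator K X n h \<omega> x - p x)\<^sup>2) \<partial>M) \<le>
      ennreal (1 / real n) * s x + ennreal ((m x - p x)\<^sup>2)" for x
    unfolding kernel_estimator_def
  proof (rule mean_squared_error_le[OF n])
    show "indep_vars (\<lambda>_. borel) (\<lambda>j \<omega>. scaled_kernel K h (x - X j \<omega>)) {1..n}"
      by (rule indep_vars_compose2[OF indep]) measurable
    show "(\<integral>\<^sup>+\<omega>. ennreal ((scaled_kernel K h (x - X j \<omega>))\<^sup>2) \<partial>M) = s x" if "j \<in> {1..n}" for j
      unfolding s_def by (rule distributed_nn_integral[OF X[OF that], symmetric]) measurable
  qed (rule mean)
  have sx: "(\<integral>\<^sup>+x. s x \<partial>lborel) = ennreal (roughness K / h)"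
  proof -
    \<comment> \<open>After exchanging integrals the inner one is independent of \<open>y\<close> by
      translation, and \<open>p\<close> integrates to 1.\<close>
    have "(\<integral>\<^sup>+x. s x \<partial>lborel) =
      (\<integral>\<^sup>+y. (\<integral>\<^sup>+x. ennreal (p y) * ennreal ((scaled_kernel K h (x - y))\<^sup>2) \<partial>lborel) \<partial>lborel)"
      unfolding s_def by (rule lborel_pair.Fubini'[symmetric]) measurable
    also have "\<dots> = (\<integral>\<^sup>+y. ennreal (p y) * ennreal (roughness K / h) \<partial>lborel)"
    proof (rule nn_integral_cong)
      fix y :: real
      have "(\<integral>\<^sup>+x. ennreal ((scaled_kernel K h (x - y))\<^sup>2) \<partial>lborel) =
          ennreal h * (\<integral>\<^sup>+u. ennreal ((1 / h)\<^sup>2) * ennreal ((K u)\<^sup>2) \<partial>lborel)"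
        using nn_integral_real_affine[of "\<lambda>x. ennreal ((scaled_kernel K h (x - y))\<^sup>2)" h y] h
        by (simp add: scaled_kernel_def power_divide flip: ennreal_mult')
      also have "\<dots> = ennreal h * (ennreal ((1 / h)\<^sup>2) * ennreal (roughness K))"
        unfolding roughness_def by (subst nn_integral_cmult) (auto simp: nn_integral_eq_integral[OF K2])
      also have "\<dots> = ennreal (roughness K / h)"
        using h by (simp add: power2_eq_square flip: ennreal_mult')
      finally show "(\<integral>\<^sup>+x. ennreal (p y) * ennreal ((scaled_kernel K h (x - y))\<^sup>2) \<partial>lborel) =
          ennreal (p y) * ennreal (roughness K / h)"
        by (subst nn_integral_cmult) auto
    qed
    also have "\<dots> = ennreal (roughness K / h)"
      by (subst nn_integral_multc) (auto simp: p_integral)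
    finally show ?thesis .
  qed
  have "MISE M (kernel_estimator K X n h) p =
      (\<integral>\<^sup>+x. (\<integral>\<^sup>+\<omega>. ennreal ((kernel_estimator K X n h \<omega> x - p x)\<^sup>2) \<partial>M) \<partial>lborel)"
    unfolding MISE_def kernel_estimator_def
    by (rule pair.Fubini'[symmetric, of "\<lambda>\<omega> x. ennreal (((\<Sum>j=1..n. scaled_kernel K h (x - X j \<omega>)) / real n - p x)\<^sup>2)"]) measurable
  also have "\<dots> \<le> (\<integral>\<^sup>+x. ennreal (1 / real n) * s x + ennreal ((m x - p x)\<^sup>2) \<partial>lborel)"
    by (intro nn_integral_mono pointwise)
  also have "\<dots> = ennreal (1 / real n) * (\<integral>\<^sup>+x. s x \<partial>lborel) + (\<integral>\<^sup>+x. ennreal ((m x - p x)\<^sup>2) \<partial>lborel)"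
    by (simp add: nn_integral_add nn_integral_cmult)
  also have "\<dots> \<le> ennreal (1 / real n) * (\<integral>\<^sup>+x. s x \<partial>lborel) +
      ennreal (h ^ 4 / 4 * (abs_moment 2 K)\<^sup>2) * (\<integral>\<^sup>+x. ennreal ((g x)\<^sup>2) \<partial>lborel)"
    unfolding m_def by (intro add_left_mono integrated_squared_bias)
  also have "ennreal (1 / real n) * (\<integral>\<^sup>+x. s x \<partial>lborel) = ennreal (roughness K / (real n * h))"
    unfolding sx by (simp add: mult.commute flip: ennreal_mult')
  finally show ?thesis .
qed

end

section \<open>The bound for bandwidths of order n to the power -1/5\<close>

lemma sum_le_total_variation:
  assumes "mono t" "total_variation f \<le> ennreal V" "0 \<le> V"
  shows "(\<Sum>i<m. \<bar>f (t (Suc i)) - f (t i)\<bar>) \<le> V"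
proof -
  have "ennreal (\<Sum>i<m. \<bar>f (t (Suc i)) - f (t i)\<bar>) = (\<Sum>i<m. ennreal \<bar>f (t (Suc i)) - f (t i)\<bar>)"
    by simp
  also have "\<dots> \<le> total_variation f"
    unfolding total_variation_def using assms(1)
    by (intro SUP_upper2[of "(m, t)"]) auto
  also have "\<dots> \<le> ennreal V" by (rule assms(2))
  finally show ?thesis using assms(3) by simp
qed

theorem theorem1:
  fixes M :: "'a measure" and X :: "nat \<Rightarrow> 'a \<Rightarrow> real" and n :: nat
    and p K :: "real \<Rightarrow> real" and h0 V2 :: real
  assumes "prob_space M"
    and "n \<ge> 1"
    and "prob_density p"
    and "prob_space.indep_vars M (\<lambda>_. borel) X {1..n}"
    and "\<And>j. j \<in> {1..n} \<Longrightarrow> distributed M lborel (X j) (\<lambda>x. ennreal (p x))"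
    and "\<And>x. p differentiable (at x)"
    and "\<And>x. deriv p differentiable (at x)"
    and "V2 \<ge> 0"
    and "total_variation (deriv (deriv p)) = ennreal V2"
    and "prob_density K"
    and "integrable lborel (\<lambda>x. (K x)\<^sup>2)"
    and "integrable lborel (\<lambda>x. \<bar>x\<bar> ^ 2 * K x)"
    and "(LINT x|lborel. x * K x) = 0"
    and "h0 > 0"
  shows "MISE M (kernel_estimator K X n (h0 * real n powr (- 1 / 5))) p
     \<le> ennreal ((3 * (abs_moment 2 K)\<^sup>2 * V2 powr (5 / 3) / (10 * pi) * h0 ^ 4 + roughness K / h0)
           * real n powr (- 4 / 5))"
proof -
  have "bv_density p (deriv p) (deriv (deriv p)) V2"
  proof
    show "(p has_real_derivative deriv p x) (at x)" for x
      using assms(6) by (simp add: DERIV_deriv_iff_real_differentiable)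
    show "(deriv p has_real_derivative deriv (deriv p) x) (at x)" for x
      using assms(7) by (simp add: DERIV_deriv_iff_real_differentiable)
    show "(\<Sum>i<m. \<bar>deriv (deriv p) (t (Suc i)) - deriv (deriv p) (t i)\<bar>) \<le> V2"
      if "mono t" for t :: "nat \<Rightarrow> real" and m
      using sum_le_total_variation[OF that] assms(8,9) by simp
  qed (use assms(3) in \<open>auto simp: prob_density_def\<close>)
  moreover have "centered_kernel K"
    using assms(10,12,13) by unfold_locales
  ultimately interpret smoothing p "deriv p" "deriv (deriv p)" V2 K
    by (simp add: smoothing_def)
  define h where "h = h0 * real n powr (- 1 / 5)"
  define \<rho> where "\<rho> = real n powr (- 4 / 5)"
  have n: "0 < real n" using assms(2) by simp
  have h: "0 < h" using assms(14) n by (simp add: h_def)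
  have "(real n powr (- 1 / 5)) ^ 4 = \<rho>" using n by (simp add: \<rho>_def powr_power)
  then have h4: "h ^ 4 = h0 ^ 4 * \<rho>" by (simp add: h_def power_mult_distrib)
  \<comment> \<open>With this bandwidth \<open>real n * h\<close> is \<open>h0 / \<rho>\<close> and
    \<open>h ^ 4\<close> is \<open>h0 ^ 4 * \<rho>\<close>, so variance and squared bias decay at
    the same rate.\<close>
  have "\<rho> * (real n * real n powr (- 1 / 5)) = real n powr (- 4 / 5 + (1 + - 1 / 5))"
    unfolding \<rho>_def powr_add using n by simp
  also have "\<dots> = 1" using n by simp
  finally have "h0 = \<rho> * (real n * h)" by (simp add: h_def ac_simps)
  moreover have "0 < \<rho>" using n by (simp add: \<rho>_def)
  ultimately have nh: "roughness K / (real n * h) = roughness K / h0 * \<rho>" by simp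
  have "MISE M (kernel_estimator K X n h) p \<le>
    ennreal (roughness K / (real n * h)) +
    ennreal (h ^ 4 / 4 * (abs_moment 2 K)\<^sup>2) * (\<integral>\<^sup>+x. ennreal ((deriv (deriv p) x)\<^sup>2) \<partial>lborel)"
    by (rule mise_kernel_estimator_le[OF assms(1,2,4,5,11) h])
  also have "\<dots> \<le> ennreal (roughness K / (real n * h)) +
    ennreal (h ^ 4 / 4 * (abs_moment 2 K)\<^sup>2) * ennreal (6 / (5 * pi) * V2 powr (5 / 3))"
    by (intro add_left_mono mult_left_mono second_derivative_roughness) auto
  also have "\<dots> = ennreal (roughness K / (real n * h) +
    h ^ 4 / 4 * (abs_moment 2 K)\<^sup>2 * (6 / (5 * pi) * V2 powr (5 / 3)))"
    using h by (subst ennreal_plus) (auto simp: roughness_def simp flip: ennreal_mult')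
  \<comment> \<open>The constants combine as 1/4 times 6/5, which is 3/10.\<close>
  also have "roughness K / (real n * h) + h ^ 4 / 4 * (abs_moment 2 K)\<^sup>2 * (6 / (5 * pi) * V2 powr (5 / 3)) =
    (3 * (abs_moment 2 K)\<^sup>2 * V2 powr (5 / 3) / (10 * pi) * h0 ^ 4 + roughness K / h0) * \<rho>"
    unfolding nh h4 by (simp add: algebra_simps)
  finally show ?thesis by (simp only: h_def \<rho>_def)
qed

end
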